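(* Let $k\ge 3$ be an integer and let $G$ be a connected graph with $\Delta(G)\geq k$. Then $L_k(G)\geq \mathrm{diam}(G)+k-2$. Moreover, the lower bound is tight: for every $k\ge 3$ there is a connected graph $G$ with $\Delta(G)\ge k$ and $L_k(G)=\mathrm{diam}(G)+k-2$.
   Context: All graphs are finite, undirected, simple and nontrivial (at least two vertices). $\Delta(G)$ is the maximum degree, $\mathrm{diam}(G)$ the diameter, and $N[v]=\{v\}\cup N(v)$ the closed neighbourhood of $v$. For an integer $k\ge 1$, a set $B\subseteq V(G)$ is a $k$-limited packing if $|N[v]\cap B|\le k$ for every vertex $v$ of $G$; $L_k(G)$ is the maximum cardinality of a $k$-limited packing in $G$. *)

theory Defs
  imports "Graph_Theory.Graph_Theory"
begin

text \<open>
  Finite simple undirected graphs are represented by the locale \<^locale>\<open>graph\<close>: an undirected edge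
  is a pair of opposite arcs, so the degree of a vertex is its \<^const>\<open>out_degree\<close>.
\<close>

definition max_degree :: "('a, 'b) pre_digraph \<Rightarrow> nat" where
  "max_degree G = Max (out_degree G ` verts G)"

text \<open>Only meaningful if \<open>v\<close> is reachable from \<open>u\<close>.\<close>
definition graph_dist :: "('a, 'b) pre_digraph \<Rightarrow> 'a \<Rightarrow> 'a \<Rightarrow> nat" where
  "graph_dist G u v = (LEAST n. \<exists>p. pre_digraph.awalk G u p v \<and> length p = n)"

text \<open>The library's weighted distance, with unit weights, is the same number.\<close>
lemma (in wf_digraph) graph_dist_eq_mu:
  assumes "u \<rightarrow>\<^sup>* v"
  shows "ereal (real (graph_dist G u v)) = \<mu> (\<lambda>_. 1) u v"
proof -
  let ?P = "\<lambda>n. \<exists>p. awalk u p v \<and> length p = n"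
  have cost: "awalk_cost (\<lambda>_. 1) p = real (length p)" for p :: "'b list"
    by (induction p) auto
  from assms obtain q where "awalk u q v"
    by (auto simp: reachable_awalk)
  then have "?P (length q)"
    by blast
  then have "?P (graph_dist G u v)"
    unfolding graph_dist_def by (rule LeastI)
  then obtain p where p: "awalk u p v" "length p = graph_dist G u v"
    by blast
  have least: "graph_dist G u v \<le> length p'" if "awalk u p' v" for p'
    unfolding graph_dist_def by (rule Least_le) (use that in blast)
  show ?thesis
    unfolding \<mu>_def
  proof (rule antisym)
    show "ereal (real (graph_dist G u v)) \<le> (INF p\<in>{p. awalk u p v}. ereal (awalk_cost (\<lambda>_. 1) p))"
      by (rule INF_greatest) (use least cost in auto)
    show "(INF p\<in>{p. awalk u p v}. ereal (awalk_cost (\<lambda>_. 1) p)) \<le> ereal (real (graph_dist G u v))"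
      by (rule INF_lower2[of p]) (use p cost in auto)
  qed
qed

definition graph_diameter :: "('a, 'b) pre_digraph \<Rightarrow> nat" where
  "graph_diameter G = Max {graph_dist G u v | u v. u \<in> verts G \<and> v \<in> verts G}"

definition closed_neighbourhood :: "('a, 'b) pre_digraph \<Rightarrow> 'a \<Rightarrow> 'a set" where
  "closed_neighbourhood G v = insert v {u. v \<rightarrow>\<^bsub>G\<^esub> u}"

definition limited_packing :: "nat \<Rightarrow> ('a, 'b) pre_digraph \<Rightarrow> 'a set \<Rightarrow> bool" where
  "limited_packing k G B \<longleftrightarrow>
     B \<subseteq> verts G \<and> (\<forall>v \<in> verts G. card (closed_neighbourhood G v \<inter> B) \<le> k)"

definition limited_packing_number :: "nat \<Rightarrow> ('a, 'b) pre_digraph \<Rightarrow> nat" where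
  "limited_packing_number k G = Max {card B | B. limited_packing k G B}"

end

theory Submission
  imports Defs
begin

text \<open>
  Fix vertices \<open>u\<close>, \<open>v\<close> at distance \<open>d = diam(G)\<close> and choose a vertex at each distance \<open>0, \<dots>, d\<close>
  from \<open>u\<close>. Distances from \<open>u\<close> vary by at most one over a closed neighbourhood in either direction, so a closed
  neighbourhood contains at most three of these \<open>d + 1\<close> vertices, and adding any \<open>k - 3\<close> further
  vertices yields a \<open>k\<close>-limited packing. Enough further vertices exist, since a vertex of degree at least \<open>k\<close>
  has at least \<open>k - 2\<close> closed neighbours outside the chosen ones. The star with \<open>k\<close> leaves attains the bound: its
  diameter is at least \<open>2\<close>, and its whole vertex set, of size \<open>k + 1\<close>, is not a packing.
\<close>

section \<open>Distance levels from a fixed vertex\<close>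

context wf_digraph
begin

lemma graph_dist_le:
  "awalk u p v \<Longrightarrow> graph_dist G u v \<le> length p"
  unfolding graph_dist_def by (rule Least_le) blast

lemma graph_dist_awalk:
  assumes "u \<rightarrow>\<^sup>* v"
  obtains p where "awalk u p v" "length p = graph_dist G u v"
proof -
  from assms obtain q where "awalk u q v"
    by (auto simp: reachable_awalk)
  then have "\<exists>n p. awalk u p v \<and> length p = n"
    by blast
  then have "\<exists>p. awalk u p v \<and> length p = graph_dist G u v"
    unfolding graph_dist_def by (rule LeastI_ex)
  then show thesis
    using that by blast
qed

lemma graph_dist_adj_le:
  assumes "u \<rightarrow>\<^sup>* x" "x \<rightarrow>\<^bsub>G\<^esub> y"
  shows "graph_dist G u y \<le> Suc (graph_dist G u x)"
proof -
  obtain p where p: "awalk u p x" "length p = graph_dist G u x"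
    using graph_dist_awalk[OF assms(1)] .
  obtain a where "a \<in> arcs G" "tail G a = x" "head G a = y"
    using assms(2) by (auto simp: arcs_ends_conv)
  then have "awalk u (p @ [a]) y"
    using p(1) by (auto simp: awalk_Cons_iff awalk_Nil_iff)
  from graph_dist_le[OF this] show ?thesis
    using p(2) by simp
qed

text \<open>Dropping the last arc of a shortest walk leaves a walk of length \<open>n\<close> to its
  tail. The tail cannot be nearer than that, since \<open>graph_dist_adj_le\<close> would then put
  \<open>y\<close> nearer than \<open>Suc n\<close>.\<close>

lemma graph_dist_predecessor:
  assumes "u \<rightarrow>\<^sup>* y" "graph_dist G u y = Suc n"
  obtains x where "u \<rightarrow>\<^sup>* x" "graph_dist G u x = n"
proof -
  obtain p where p: "awalk u p y" "length p = Suc n"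
    using graph_dist_awalk[OF assms(1)] unfolding assms(2) .
  then obtain q a where q: "p = q @ [a]" "length q = n"
    by (metis length_Suc_conv_rev)
  then have walk: "awalk u q (tail G a)" and a: "a \<in> arcs G" "head G a = y"
    using p(1) by (auto simp: awalk_Cons_iff awalk_Nil_iff)
  then have reach: "u \<rightarrow>\<^sup>* tail G a"
    by (auto simp: reachable_awalk)
  have "tail G a \<rightarrow>\<^bsub>G\<^esub> y"
    using a by (auto simp: arcs_ends_conv)
  from graph_dist_adj_le[OF reach this] graph_dist_le[OF walk] q(2) assms(2)
  have "graph_dist G u (tail G a) = n"
    by simp
  with reach show thesis
    by (rule that)
qed

text \<open>Descending induction from the distance of \<open>v\<close>: each step passes to a
  predecessor one level nearer to \<open>u\<close>.\<close>

lemma graph_dist_level: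
  assumes "u \<rightarrow>\<^sup>* v" "i \<le> graph_dist G u v"
  shows "\<exists>x. u \<rightarrow>\<^sup>* x \<and> graph_dist G u x = i"
  using assms(2)
proof (induction rule: inc_induct)
  case base
  then show ?case
    using assms(1) by blast
next
  case (step n)
  then show ?case
    by (blast elim: graph_dist_predecessor)
qed

end

section \<open>Extremal values, degrees and reachability\<close>

context fin_digraph
begin

lemma finite_graph_dists:
  "finite {graph_dist G u v |u v. u \<in> verts G \<and> v \<in> verts G}"
  by (rule finite_image_set2) auto

lemma graph_dist_le_diameter:
  "u \<in> verts G \<Longrightarrow> v \<in> verts G \<Longrightarrow> graph_dist G u v \<le> graph_diameter G"
  unfolding graph_diameter_def by (rule Max_ge[OF finite_graph_dists]) auto

lemma graph_diameter_attained:
  assumes "verts G \<noteq> {}"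
  obtains u v where "u \<in> verts G" "v \<in> verts G" "graph_dist G u v = graph_diameter G"
proof -
  have "graph_diameter G \<in> {graph_dist G u v |u v. u \<in> verts G \<and> v \<in> verts G}"
    unfolding graph_diameter_def using assms by (intro Max_in[OF finite_graph_dists]) auto
  then show thesis
    using that by auto
qed

lemma max_degree_attained:
  assumes "verts G \<noteq> {}"
  obtains w where "w \<in> verts G" "out_degree G w = max_degree G"
proof -
  have "max_degree G \<in> out_degree G ` verts G"
    unfolding max_degree_def using assms by (intro Max_in) auto
  then show thesis
    using that by auto
qed

lemma out_degree_le_max_degree:
  "w \<in> verts G \<Longrightarrow> out_degree G w \<le> max_degree G"
  unfolding max_degree_def by (intro Max_ge) auto

lemma finite_packing_sizes:
  "finite {card B |B. limited_packing k G B}"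
proof -
  have "{card B |B. limited_packing k G B} \<subseteq> card ` Pow (verts G)"
    by (auto simp: limited_packing_def)
  then show ?thesis
    by (rule finite_subset) simp
qed

lemma card_le_limited_packing_number:
  "limited_packing k G B \<Longrightarrow> card B \<le> limited_packing_number k G"
  unfolding limited_packing_number_def
  by (rule Max_ge[OF finite_packing_sizes]) blast

lemma limited_packing_number_le:
  assumes "\<And>B. limited_packing k G B \<Longrightarrow> card B \<le> n"
  shows "limited_packing_number k G \<le> n"
proof -
  \<comment> \<open>The empty packing makes the set under \<open>Max\<close> nonempty, as
    \<open>Max_le_iff\<close> requires.\<close>
  have "limited_packing k G {}"
    by (simp add: limited_packing_def)
  then have "{card B |B. limited_packing k G B} \<noteq> {}"
    by blast
  from Max_le_iff[OF finite_packing_sizes this] show ?thesis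
    unfolding limited_packing_number_def using assms by auto
qed

end

text \<open>Without parallel arcs, out-arcs correspond to neighbours; without loops,
  \<open>v\<close> itself is one further element.\<close>

lemma (in digraph) card_closed_neighbourhood:
  "card (closed_neighbourhood G v) = Suc (out_degree G v)"
proof -
  have nb: "{u. v \<rightarrow>\<^bsub>G\<^esub> u} = head G ` out_arcs G v"
    by (auto simp: arcs_ends_conv)
  have "inj_on (head G) (out_arcs G v)"
    by (intro inj_onI no_multi_arcs) (auto simp: arc_to_ends_def)
  then have "card {u. v \<rightarrow>\<^bsub>G\<^esub> u} = out_degree G v"
    unfolding nb out_degree_def by (rule card_image)
  moreover have "v \<notin> {u. v \<rightarrow>\<^bsub>G\<^esub> u}"
    by (auto dest: adj_not_same)
  moreover have "finite {u. v \<rightarrow>\<^bsub>G\<^esub> u}"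
    unfolding nb by auto
  ultimately show ?thesis
    unfolding closed_neighbourhood_def by simp
qed

lemma (in sym_digraph) connected_imp_reachable:
  "connected G \<Longrightarrow> u \<in> verts G \<Longrightarrow> v \<in> verts G \<Longrightarrow> u \<rightarrow>\<^sup>* v"
  using symmetric_connected_imp_strongly_connected[OF sym_arcs] by (auto simp: strongly_connected_def)

section \<open>The lower bound\<close>

theorem (in graph) limited_packing_number_ge:
  assumes conn: "connected G" and deg: "max_degree G \<ge> k" and k: "k \<ge> 3"
  shows "limited_packing_number k G \<ge> graph_diameter G + k - 2"
proof -
  define d where "d = graph_diameter G"
  have ne: "verts G \<noteq> {}"
    using conn by (auto simp: connected_def strongly_connected_def mk_symmetric_def)
  obtain u v where uv: "u \<in> verts G" "v \<in> verts G" "graph_dist G u v = d"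
    unfolding d_def using graph_diameter_attained[OF ne] .
  obtain w where w: "w \<in> verts G" "out_degree G w \<ge> k"
    using max_degree_attained[OF ne] deg by metis
  have reach: "u \<rightarrow>\<^sup>* x" if "x \<in> verts G" for x
    using connected_imp_reachable[OF conn uv(1) that] .
  have "\<forall>i\<in>{..d}. \<exists>x. x \<in> verts G \<and> graph_dist G u x = i"
    using graph_dist_level[OF reach[OF uv(2)]] uv(3) reachable_in_verts(2) by fastforce
  then obtain f where f: "\<forall>i\<in>{..d}. f i \<in> verts G \<and> graph_dist G u (f i) = i"
    by metis
  define P where "P = f ` {..d}"
  have P: "P \<subseteq> verts G" "finite P"
    using f by (auto simp: P_def)
  have inj: "inj_on f {..d}"
    using f by (metis inj_onI)
  have card_P: "card P = Suc d"
    unfolding P_def by (simp add: card_image[OF inj])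
  \<comment> \<open>Each level is represented once in \<open>P\<close>, so subsets of
    \<open>P\<close> can be counted by their distances from \<open>u\<close>.\<close>
  have inj_P: "inj_on (graph_dist G u) P"
    unfolding P_def using f by (auto intro!: inj_onI)
  have three: "card (closed_neighbourhood G x \<inter> P) \<le> 3" if x: "x \<in> verts G" for x
  proof -
    let ?n = "graph_dist G u x"
    \<comment> \<open>If \<open>?n\<close> is \<open>0\<close>, subtraction truncates and the
      interval has two elements; otherwise it has three.\<close>
    have "graph_dist G u y \<in> {?n - 1..?n + 1}" if y: "y \<in> closed_neighbourhood G x" for y
    proof (cases "y = x")
      case False
      then have xy: "x \<rightarrow>\<^bsub>G\<^esub> y"
        using y by (auto simp: closed_neighbourhood_def)
      \<comment> \<open>An arc bounds the distance of its head by that of its tail, so the reverse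
        arc supplies the bound from below.\<close>
      then have yx: "y \<rightarrow>\<^bsub>G\<^esub> x"
        by (rule arcs_ends_symmetric[OF sym_arcs])
      have "y \<in> verts G"
        using xy by (rule adj_in_verts)
      then show ?thesis
        using graph_dist_adj_le[OF reach[OF x] xy] graph_dist_adj_le[OF reach yx] by auto
    qed auto
    then have "graph_dist G u ` (closed_neighbourhood G x \<inter> P) \<subseteq> {?n - 1..?n + 1}"
      by auto
    then have "card (closed_neighbourhood G x \<inter> P) \<le> card {?n - 1..?n + 1}"
      by (intro card_inj_on_le[OF inj_on_subset[OF inj_P]]) auto
    then show ?thesis
      by simp
  qed
  \<comment> \<open>The closed neighbourhood of \<open>w\<close> has at least \<open>k + 1\<close>
    elements, at most three of them in \<open>P\<close>.\<close>
  have "k - 3 \<le> card (closed_neighbourhood G w - P)"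
    using card_closed_neighbourhood[of w] three[OF w(1)] w(2)
      card_Diff_subset_Int[of "closed_neighbourhood G w" P] P(2) by simp
  then obtain S where S: "S \<subseteq> closed_neighbourhood G w - P" "card S = k - 3" "finite S"
    by (rule obtain_subset_with_card_n)
  have S_verts: "S \<subseteq> verts G"
    using S(1) w(1) by (auto simp: closed_neighbourhood_def dest: adj_in_verts)
  have "limited_packing k G (P \<union> S)"
    unfolding limited_packing_def
  proof (intro conjI ballI)
    show "P \<union> S \<subseteq> verts G"
      using P S_verts by simp
  next
    fix x assume x: "x \<in> verts G"
    have "card (closed_neighbourhood G x \<inter> (P \<union> S))
        \<le> card (closed_neighbourhood G x \<inter> P) + card (closed_neighbourhood G x \<inter> S)"
      unfolding Int_Un_distrib by (rule card_Un_le)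
    \<comment> \<open>Even if all of \<open>S\<close> lies in the closed neighbourhood of
      \<open>x\<close>, it adds only \<open>k - 3\<close> elements.\<close>
    also have "\<dots> \<le> 3 + card S"
      using three[OF x] S(3) by (intro add_mono card_mono) auto
    finally show "card (closed_neighbourhood G x \<inter> (P \<union> S)) \<le> k"
      using S(2) k by simp
  qed
  from card_le_limited_packing_number[OF this]
  have "card (P \<union> S) \<le> limited_packing_number k G" .
  moreover have "card (P \<union> S) = Suc d + (k - 3)"
    using S P card_P by (subst card_Un_disjoint) auto
  ultimately show ?thesis
    using k by (simp add: d_def)
qed

section \<open>Tightness: the star with centre \<open>0\<close>\<close>

definition star :: "nat \<Rightarrow> (nat, nat \<times> nat) pre_digraph" where
  "star k = \<lparr>verts = {..k}, arcs = {0} \<times> {1..k} \<union> {1..k} \<times> {0}, tail = fst, head = snd\<rparr>"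

lemma verts_star [simp]: "verts (star k) = {..k}"
  by (simp add: star_def)

lemma tail_star [simp]: "tail (star k) = fst"
  by (simp add: star_def)

lemma head_star [simp]: "head (star k) = snd"
  by (simp add: star_def)

lemma arcs_star [simp]: "arcs (star k) = {0} \<times> {1..k} \<union> {1..k} \<times> {0}"
  by (simp add: star_def)

lemma arcs_ends_star [simp]: "arcs_ends (star k) = {0} \<times> {1..k} \<union> {1..k} \<times> {0}"
  by (force simp: arcs_ends_conv)

lemma graph_star: "graph (star k)"
proof
  show "symmetric (star k)"
    unfolding symmetric_def by (auto simp: sym_def)
qed (auto simp: arc_to_ends_def)

lemma connected_star: "connected (star k)"
proof -
  interpret graph "star k"
    by (rule graph_star)
  have "0 \<rightarrow>\<^sup>*\<^bsub>star k\<^esub> v" if "v \<in> verts (star k)" for v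
    using that by (cases "v = 0") auto
  then have "u \<rightarrow>\<^sup>*\<^bsub>star k\<^esub> v" if "u \<in> verts (star k)" "v \<in> verts (star k)" for u v
    using that symmetric_reachable' reachable_trans by blast
  then show ?thesis
    \<comment> \<open>Connectivity is strong connectivity of the symmetric closure, which has the
      same reachability here because the arcs are already symmetric.\<close>
    unfolding connected_def strongly_connected_def reachable_mk_symmetric_eq[OF sym_arcs]
    by (auto simp: mk_symmetric_def)
qed

lemma closed_neighbourhood_star_centre: "closed_neighbourhood (star k) 0 = {..k}"
  by (auto simp: closed_neighbourhood_def)

text \<open>The closed neighbourhood of the centre consists of all \<open>k + 1\<close>
  vertices.\<close>

lemma max_degree_star_ge: "max_degree (star k) \<ge> k"
proof -
  interpret graph "star k"
    by (rule graph_star)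
  show ?thesis
    using card_closed_neighbourhood[of 0] out_degree_le_max_degree[of 0]
    by (simp add: closed_neighbourhood_star_centre)
qed

lemma graph_diameter_star_ge:
  assumes "k \<ge> 2"
  shows "graph_diameter (star k) \<ge> 2"
proof -
  interpret graph "star k"
    by (rule graph_star)
  have "1 \<rightarrow>\<^sup>*\<^bsub>star k\<^esub> 2"
    using assms by (intro connected_imp_reachable connected_star) auto
  then obtain p where p: "awalk 1 p 2" "length p = graph_dist (star k) 1 2"
    by (rule graph_dist_awalk)
  have "length p \<ge> 2"
  \<comment> \<open>The empty walk would identify the leaves \<open>1\<close> and \<open>2\<close>,
    and a single arc would join two leaves.\<close>
  proof (cases p)
    case Nil
    then show ?thesis
      using p(1) by (simp add: awalk_Nil_iff)
  next
    case (Cons a q)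
    then show ?thesis
      using p(1) by (cases q) (auto simp: awalk_Cons_iff awalk_Nil_iff)
  qed
  then show ?thesis
    using graph_dist_le_diameter[of 1 2] assms p(2) by simp
qed

text \<open>The constraint at the centre already bounds the whole packing.\<close>

lemma limited_packing_number_star_le: "limited_packing_number k (star k) \<le> k"
proof -
  interpret graph "star k"
    by (rule graph_star)
  have "card B \<le> k" if B: "limited_packing k (star k) B" for B
  proof -
    have "B \<subseteq> {..k}" "card (closed_neighbourhood (star k) 0 \<inter> B) \<le> k"
      using B by (auto simp: limited_packing_def)
    then show ?thesis
      by (simp add: closed_neighbourhood_star_centre Int_absorb1)
  qed
  then show ?thesis
    by (rule limited_packing_number_le)
qed

theorem theorem3p6:
  fixes k :: nat
  assumes "k \<ge> 3"
  shows "(\<forall>G :: ('a, 'b) pre_digraph.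
            graph G \<and> card (verts G) \<ge> 2 \<and> connected G \<and> max_degree G \<ge> k \<longrightarrow>
            limited_packing_number k G \<ge> graph_diameter G + k - 2) \<and>
         (\<exists>G :: (nat, nat \<times> nat) pre_digraph.
            graph G \<and> card (verts G) \<ge> 2 \<and> connected G \<and> max_degree G \<ge> k \<and>
            limited_packing_number k G = graph_diameter G + k - 2)"
proof (intro conjI allI impI exI)
  fix G :: "('a, 'b) pre_digraph"
  assume "graph G \<and> card (verts G) \<ge> 2 \<and> connected G \<and> max_degree G \<ge> k"
  then show "limited_packing_number k G \<ge> graph_diameter G + k - 2"
    using graph.limited_packing_number_ge assms by blast
next
  \<comment> \<open>The general bound, the cap \<open>k\<close> on packings and diameter at least
    \<open>2\<close> close into a cycle of inequalities, forcing equality throughout.\<close>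
  show "limited_packing_number k (star k) = graph_diameter (star k) + k - 2"
    using graph.limited_packing_number_ge[OF graph_star connected_star max_degree_star_ge assms]
      limited_packing_number_star_le[of k] graph_diameter_star_ge[of k] assms by linarith
qed (use assms in \<open>simp_all add: graph_star connected_star max_degree_star_ge\<close>)

end
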